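(* Consider a $K\times N$ multicast switch with a traffic pattern having rational rate vector $\mathbf r$ and enhanced rate vector $\mathbf e$, where fanout splitting and linear network coding are allowed. The following are equivalent: (1) $\mathbf e\in STAB(G)$, where $G$ is the enhanced conflict graph; (2) there exist a coding scheme and a frame-based schedule with frame size $F$ such that for every flow $(i,J)$, $r_{iJ}F$ is an integer, and, for all $n\ge1$, the oldest $r_{iJ}F$ packets that were in the queue of flow $(i,J)$ at the end of frame $n-1$ are served by the end of frame $n$ (and if there were fewer than $r_{iJ}F$ packets, all of them are served).
   Context: Switch: inputs $[K]$, outputs $[N]$, slotted time. A flow is $(i,J)$ with input $i$ and nonempty fanout $J\subseteq[N]$, with rate $r_{iJ}$; each flow's packets arrive into a queue at input $i$ (queues start empty). Subflows: $(i,J,j)$, $j\in J$. A switch configuration for one slot: each input idles or picks one of its flows $(i,J)$ and connects to a subset of $J$, sending one packet to all connected outputs; each output is connected to at most one input. With linear network coding the packet sent for flow $(i,J)$ is a linear combination over a finite field of packets of that flow held at input $i$. A frame is a block of $F$ consecutive slots; a frame-based schedule is a fixed sequence of $F$ configurations repeated in every frame. A packet is served when it has been conveyed to (is decodable at) all outputs in the fanout of its flow and removed from the queue. Enhanced rate vector: $\mathbf e_{iJj}=r_{iJ}$. Enhanced conflict graph $G$: one vertex per subflow; distinct $(i,J,j),(i',J',j')$ adjacent iff $j=j'$, or $i=i'$ and $J\ne J'$. $STAB(G)$ is the convex hull of incidence vectors of stable sets of $G$. *)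

theory Defs
  imports Complex_Main "HOL-Algebra.Ring"
begin

type_synonym subflow = "nat \<times> nat set \<times> nat"

definition is_flow :: "nat \<Rightarrow> nat \<Rightarrow> nat \<Rightarrow> nat set \<Rightarrow> bool" where
  "is_flow K N i J \<longleftrightarrow> i < K \<and> J \<subseteq> {..<N} \<and> J \<noteq> {}"

definition subflows :: "nat \<Rightarrow> nat \<Rightarrow> subflow set" where
  "subflows K N = {(i, J, j). is_flow K N i J \<and> j \<in> J}"

definition enh_adj :: "subflow \<Rightarrow> subflow \<Rightarrow> bool" where
  "enh_adj v w = (case v of (i, J, j) \<Rightarrow> case w of (i', J', j') \<Rightarrow>
      v \<noteq> w \<and> (j = j' \<or> (i = i' \<and> J \<noteq> J')))"

definition stable_set :: "'v set \<Rightarrow> ('v \<Rightarrow> 'v \<Rightarrow> bool) \<Rightarrow> 'v set \<Rightarrow> bool" where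
  "stable_set V adj S \<longleftrightarrow> S \<subseteq> V \<and> (\<forall>v\<in>S. \<forall>w\<in>S. \<not> adj v w)"

definition incidence :: "'v set \<Rightarrow> 'v \<Rightarrow> real" where
  "incidence S = (\<lambda>v. if v \<in> S then 1 else 0)"

text \<open>STAB(G): the convex hull of the incidence vectors of stable sets, written out as the
set of finite convex combinations (vectors are real-valued functions on the vertex type,
vanishing outside V).\<close>
definition STAB :: "'v set \<Rightarrow> ('v \<Rightarrow> 'v \<Rightarrow> bool) \<Rightarrow> ('v \<Rightarrow> real) set" where
  "STAB V adj = {x. \<exists>T (c :: 'v set \<Rightarrow> real). finite T \<and> (\<forall>S\<in>T. stable_set V adj S) \<and>
      (\<forall>S\<in>T. 0 \<le> c S) \<and> sum c T = 1 \<and> x = (\<lambda>v. \<Sum>S\<in>T. c S * incidence S v)}"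

definition enhanced :: "nat \<Rightarrow> nat \<Rightarrow> (nat \<Rightarrow> nat set \<Rightarrow> real) \<Rightarrow> subflow \<Rightarrow> real" where
  "enhanced K N r = (\<lambda>(i, J, j). if (i, J, j) \<in> subflows K N then r i J else 0)"

text \<open>A configuration maps input i to None (idle) or Some (J, D): input i serves flow (i,J)
and is connected to the set D of outputs (fanout splitting: D a subset of J).\<close>
type_synonym config = "nat \<Rightarrow> (nat set \<times> nat set) option"

definition valid_config :: "nat \<Rightarrow> nat \<Rightarrow> config \<Rightarrow> bool" where
  "valid_config K N c \<longleftrightarrow>
     (\<forall>i. K \<le> i \<longrightarrow> c i = None) \<and>
     (\<forall>i J D. c i = Some (J, D) \<longrightarrow> is_flow K N i J \<and> D \<subseteq> J) \<and>
     (\<forall>i i' J D J' D'. i \<noteq> i' \<and> c i = Some (J, D) \<and> c i' = Some (J', D') \<longrightarrow> D \<inter> D' = {})"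

text \<open>A frame-based schedule with frame size F: slot t uses configuration sched (t mod F).
Frame n (n >= 1) consists of slots (n-1)F, ..., nF-1; "time T" means before slot T
(so the end of frame n is time nF).\<close>

text \<open>An arrival process a: a t i J = number of packets of flow (i,J) arriving during slot t;
they are available from slot t+1 on. Packets of a flow are numbered 0,1,2,... in order of
arrival (smaller index = older).\<close>
type_synonym arrivals = "nat \<Rightarrow> nat \<Rightarrow> nat set \<Rightarrow> nat"

definition arrived :: "arrivals \<Rightarrow> nat \<Rightarrow> nat \<Rightarrow> nat set \<Rightarrow> nat" where
  "arrived a t i J = (\<Sum>s<t. a s i J)"

text \<open>Linear network coding over a finite field R (a HOL-Algebra field with carrier in nat).
A coding scheme code a t i gives the coefficient vector (indexed by packet number of the
flow that input i serves in slot t) of the packet sent by input i in slot t under arrival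
process a.\<close>
type_synonym coding = "arrivals \<Rightarrow> nat \<Rightarrow> nat \<Rightarrow> nat \<Rightarrow> nat"

definition received :: "(nat \<Rightarrow> config) \<Rightarrow> nat \<Rightarrow> coding \<Rightarrow> arrivals \<Rightarrow> nat \<Rightarrow> nat \<Rightarrow> nat set \<Rightarrow> nat
    \<Rightarrow> (nat \<Rightarrow> nat) set" where
  "received sched F code a t i J j =
     {code a s i | s. s < t \<and> (\<exists>D. sched (s mod F) i = Some (J, D) \<and> j \<in> D)}"

definition in_span :: "nat ring \<Rightarrow> (nat \<Rightarrow> nat) set \<Rightarrow> (nat \<Rightarrow> nat) \<Rightarrow> bool" where
  "in_span R X y \<longleftrightarrow> (\<exists>S c. finite S \<and> S \<subseteq> X \<and> (\<forall>v\<in>S. c v \<in> carrier R) \<and>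
      y = (\<lambda>k. finsum R (\<lambda>v. c v \<otimes>\<^bsub>R\<^esub> v k) S))"

definition unit_vec :: "nat ring \<Rightarrow> nat \<Rightarrow> nat \<Rightarrow> nat" where
  "unit_vec R m = (\<lambda>k. if k = m then \<one>\<^bsub>R\<^esub> else \<zero>\<^bsub>R\<^esub>)"

definition served :: "nat ring \<Rightarrow> (nat \<Rightarrow> config) \<Rightarrow> nat \<Rightarrow> coding \<Rightarrow> arrivals \<Rightarrow> nat \<Rightarrow> nat
    \<Rightarrow> nat set \<Rightarrow> nat \<Rightarrow> bool" where
  "served R sched F code a t i J m \<longleftrightarrow> m < arrived a t i J \<and>
     (\<forall>j\<in>J. in_span R (received sched F code a t i J j) (unit_vec R m))"

definition queue :: "nat ring \<Rightarrow> (nat \<Rightarrow> config) \<Rightarrow> nat \<Rightarrow> coding \<Rightarrow> arrivals \<Rightarrow> nat \<Rightarrow> nat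
    \<Rightarrow> nat set \<Rightarrow> nat set" where
  "queue R sched F code a t i J = {m. m < arrived a t i J \<and> \<not> served R sched F code a t i J m}"

definition valid_code :: "nat ring \<Rightarrow> (nat \<Rightarrow> config) \<Rightarrow> nat \<Rightarrow> coding \<Rightarrow> bool" where
  "valid_code R sched F code \<longleftrightarrow>
     (\<forall>a a' t. (\<forall>s<t. a s = a' s) \<longrightarrow> code a t = code a' t) \<and>
     (\<forall>a t i J D. sched (t mod F) i = Some (J, D) \<longrightarrow>
        (\<forall>k. code a t i k \<in> carrier R) \<and>
        {k. code a t i k \<noteq> \<zero>\<^bsub>R\<^esub>} \<subseteq> queue R sched F code a t i J)"

definition frame_guarantee :: "nat ring \<Rightarrow> nat \<Rightarrow> nat \<Rightarrow> (nat \<Rightarrow> nat set \<Rightarrow> real) \<Rightarrow> nat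
    \<Rightarrow> (nat \<Rightarrow> config) \<Rightarrow> coding \<Rightarrow> bool" where
  "frame_guarantee R K N r F sched code \<longleftrightarrow>
     (\<forall>a n i J. is_flow K N i J \<and> 1 \<le> n \<longrightarrow>
        (\<forall>m \<in> queue R sched F code a ((n - 1) * F) i J.
           real (card {m' \<in> queue R sched F code a ((n - 1) * F) i J. m' < m}) < r i J * real F
           \<longrightarrow> served R sched F code a (n * F) i J m))"

end

theory Submission
  imports Defs
    "HOL-Analysis.Kronecker_Approximation_Theorem"
    "HOL-Algebra.Weak_Morphisms"
    "HOL-Number_Theory.Residues"
begin

text \<open>Each slot of a frame determines a stable set, so a frame-based schedule is a sequence of
\<open>F\<close> stable sets, and the real content is to match the number of slots in which output \<open>j\<close> listens
to flow \<open>(i, J)\<close> with \<open>r i J * F\<close>.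

From a schedule to \<open>STAB\<close>: if \<open>r i J * F\<close> packets wait at the start of a frame, all of them must be
decodable from the packets output \<open>j\<close> receives during that frame, so by counting vectors over the
finite field it hears the flow in at least \<open>r i J * F\<close> slots; surplus slots can be dropped because
subsets of stable sets are stable.

From \<open>STAB\<close> to a schedule: simultaneous Dirichlet approximation makes the convex weights rational
without disturbing the rational vector, which gives the frame. Input \<open>i\<close> codes the oldest
\<open>r i J * F\<close> packets with Vandermonde coefficients, one evaluation point per slot, so that an output
can decode whatever set of slots it listens in. Packets that leave the queue during the frame are
omitted from the combination; every output already knows them, so it loses nothing.\<close>

section \<open>Points of the stable set polytope as finite sequences of stable sets\<close>

lemma STAB_outside: "x \<in> STAB V adj \<Longrightarrow> v \<notin> V \<Longrightarrow> x v = 0"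
proof -
  assume x: "x \<in> STAB V adj" and v: "v \<notin> V"
  obtain T c where T: "\<forall>S\<in>T. stable_set V adj S" "x = (\<lambda>v. \<Sum>S\<in>T. c S * incidence S v)"
    using x unfolding STAB_def by blast
  have "v \<notin> S" if "S \<in> T" for S
    using T(1) that v by (auto simp: stable_set_def)
  then show "x v = 0"
    by (simp add: T(2) incidence_def)
qed

text \<open>Grouping the slots by the stable set they carry gives the convex combination: the weight
  of a set is the fraction of slots that use it.\<close>

lemma STAB_slotsI:
  fixes x :: "'v \<Rightarrow> real"
  assumes "0 < F" and S: "\<And>k. k < F \<Longrightarrow> stable_set V adj (S k)"
    and cnt: "\<And>v. real (card {k. k < F \<and> v \<in> S k}) = x v * real F"
  shows "x \<in> STAB V adj"
proof -
  define c where "c X = real (card {k. k < F \<and> S k = X}) / real F" for X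
  have weighted: "(\<Sum>X\<in>S ` {..<F}. c X * g X) = (\<Sum>k<F. g (S k)) / real F" for g :: "'v set \<Rightarrow> real"
  proof -
    have "(\<Sum>k<F. g (S k)) = (\<Sum>X\<in>S ` {..<F}. \<Sum>k\<in>{k\<in>{..<F}. S k = X}. g (S k))"
      by (rule sum.image_gen) simp
    also have "\<dots> = (\<Sum>X\<in>S ` {..<F}. real (card {k. k < F \<and> S k = X}) * g X)"
      by (intro sum.cong) auto
    finally show ?thesis
      by (simp add: c_def sum_divide_distrib)
  qed
  have "x v = (\<Sum>X\<in>S ` {..<F}. c X * incidence X v)" for v
  proof -
    have "(\<Sum>k<F. incidence (S k) v) = real (card {k. k < F \<and> v \<in> S k})"
      by (simp add: incidence_def sum.If_cases Int_def)
    then show ?thesis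
      using cnt[of v] \<open>0 < F\<close> by (simp add: weighted field_simps)
  qed
  moreover have "sum c (S ` {..<F}) = 1"
    using weighted[of "\<lambda>_. 1"] \<open>0 < F\<close> by simp
  moreover have "\<forall>X\<in>S ` {..<F}. 0 \<le> c X"
    by (simp add: c_def)
  ultimately show ?thesis
    unfolding STAB_def using S
    by (intro CollectI exI[of _ "S ` {..<F}"] exI[of _ c]) auto
qed

lemma common_denominator:
  fixes x :: "'v \<Rightarrow> real"
  assumes "finite V" "\<And>v. v \<in> V \<Longrightarrow> x v \<in> \<rat>"
  shows "\<exists>D::nat. 0 < D \<and> (\<forall>v\<in>V. real D * x v \<in> \<int>)"
  using assms
proof (induction V rule: finite_induct)
  case empty
  then show ?case by auto
next
  case (insert w V)
  then obtain D :: nat where D: "0 < D" "\<forall>v\<in>V. real D * x v \<in> \<int>" by auto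
  obtain m n where mn: "n \<noteq> 0" "\<bar>x w\<bar> = real m / real n"
    using Rats_abs_nat_div_natE[of "x w"] insert.prems by (metis insertI1)
  have "real n * x w \<in> \<int>"
  proof -
    have "real n * x w = real m \<or> real n * x w = - real m"
      using mn by (auto simp: abs_if field_simps split: if_splits)
    then show ?thesis by auto
  qed
  then have "real (D * n) * x w \<in> \<int>"
    using Ints_mult[of "real D" "real n * x w"] by (simp add: mult.assoc)
  moreover have "real (D * n) * x v \<in> \<int>" if "v \<in> V" for v
    using D(2) that Ints_mult[of "real n" "real D * x v"] by (simp add: ac_simps)
  ultimately show ?case
    using D(1) mn(1) by (intro exI[of _ "D * n"]) auto
qed

text \<open>Laying out a frame in blocks, one block of \<open>p X\<close> slots for each set
  \<open>X\<close>, turns slot counts into sums of multiplicities.\<close>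

lemma card_nth_concat_replicate:
  "card {k. k < length (concat (map (\<lambda>X. replicate (p X) X) Xs)) \<and>
        v \<in> concat (map (\<lambda>X. replicate (p X) X) Xs) ! k}
     = (\<Sum>X\<leftarrow>Xs. if v \<in> X then p X else 0)"
  unfolding length_filter_conv_card[symmetric]
  by (induction Xs) auto

text \<open>If the error of simultaneous approximation, summed over all weights, is below 1, then
the approximating numerators satisfy exactly every integral linear relation with 0/1
coefficients that the weights satisfy.\<close>

lemma STAB_imp_slots:
  fixes x :: "'v \<Rightarrow> real"
  assumes x: "x \<in> STAB V adj" and V: "finite V" "\<And>v. v \<in> V \<Longrightarrow> x v \<in> \<rat>"
  shows "\<exists>F S. 0 < F \<and> (\<forall>k<F. stable_set V adj (S k)) \<and>
    (\<forall>v. real (card {k. k < F \<and> v \<in> S k}) = x v * real F)"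
proof -
  obtain T c where T: "finite T" "\<forall>S\<in>T. stable_set V adj S" "\<forall>S\<in>T. 0 \<le> c S" "sum c T = 1"
    and xT: "x = (\<lambda>v. \<Sum>S\<in>T. c S * incidence S v)"
    using x unfolding STAB_def by blast
  obtain D :: nat where D: "0 < D" "\<forall>v\<in>V. real D * x v \<in> \<int>"
    using common_denominator[of V x, OF V] by auto
  have Dx: "real D * x v \<in> \<int>" for v
    using D(2) STAB_outside[OF x, of v] by (cases "v \<in> V") auto
  obtain Xs where Xs: "set Xs = T" "distinct Xs"
    using finite_distinct_list[OF T(1)] by blast
  define n where "n = length Xs"
  \<comment> \<open>One denominator \<open>q\<close> serves all \<open>n\<close> weights, and the
    accuracy \<open>1 / Suc n\<close> keeps even the sum of \<open>n\<close> errors below 1. The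
    weights are scaled by \<open>D\<close> first so that the sums of interest are integers.\<close>
  obtain q p0 where q: "0 < q"
    and p0: "\<And>i. i < n \<Longrightarrow> \<bar>of_int q * (real D * c (Xs ! i)) - of_int (p0 i)\<bar> < 1 / real (Suc n)"
    by (rule Dirichlet_approx_simult[of "Suc n" n "\<lambda>i. real D * c (Xs ! i)"]) (simp, blast)
  have "\<exists>p. \<bar>of_int q * (real D * c X) - of_int p\<bar> < 1 / real (Suc n)" if "X \<in> T" for X
    using that p0 unfolding Xs(1)[symmetric] in_set_conv_nth n_def by blast
  then obtain p where p: "\<And>X. X \<in> T \<Longrightarrow> \<bar>of_int q * (real D * c X) - of_int (p X)\<bar> < 1 / real (Suc n)"
    by metis
  have p_nonneg: "0 \<le> p X" if "X \<in> T" for X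
  proof -
    have "0 \<le> of_int q * (real D * c X)"
      using T(3) q that by simp
    moreover have "1 / real (Suc n) \<le> 1" by simp
    ultimately have "(-1::real) < of_int (p X)"
      using p[OF that] by linarith
    then show ?thesis by linarith
  qed
  \<comment> \<open>Two integers at distance less than 1 coincide. This is applied to all of
    \<open>T\<close>, whose weights sum to 1, and to the sets containing a given vertex; the first
    case forces the frame size \<open>q * D\<close>.\<close>
  have exact: "(\<Sum>X\<in>T'. real_of_int (p X)) = of_int q * (real D * sum c T')"
    if T': "T' \<subseteq> T" and int: "real D * sum c T' \<in> \<int>" for T'
  proof -
    have fin: "finite T'" using T' T(1) finite_subset by blast
    have "card T' \<le> n"
      using card_mono[OF T(1) T'] Xs distinct_card n_def by metis
    have "\<bar>of_int q * (real D * sum c T') - (\<Sum>X\<in>T'. real_of_int (p X))\<bar>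
        = \<bar>\<Sum>X\<in>T'. of_int q * (real D * c X) - of_int (p X)\<bar>"
      by (simp add: sum_subtractf sum_distrib_left)
    also have "\<dots> \<le> (\<Sum>X\<in>T'. \<bar>of_int q * (real D * c X) - of_int (p X)\<bar>)"
      by (rule sum_abs)
    also have "\<dots> \<le> (\<Sum>X\<in>T'. 1 / real (Suc n))"
      using p T' by (intro sum_mono) (meson less_imp_le subsetD)
    also have "\<dots> < 1"
      using \<open>card T' \<le> n\<close> by simp
    finally have less: "\<bar>of_int q * (real D * sum c T') - (\<Sum>X\<in>T'. real_of_int (p X))\<bar> < 1" .
    obtain z where "real D * sum c T' = of_int z"
      using int by (auto elim: Ints_cases)
    then have "\<bar>real_of_int (q * z - (\<Sum>X\<in>T'. p X))\<bar> < 1"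
      using less by simp
    then have "q * z = (\<Sum>X\<in>T'. p X)"
      by linarith
    then show ?thesis
      using \<open>real D * sum c T' = of_int z\<close> by (simp flip: of_int_sum of_int_mult)
  qed
  define L where "L = concat (map (\<lambda>X. replicate (nat (p X)) X) Xs)"
  define F where "F = nat q * D"
  have real_p: "real (nat (p X)) = of_int (p X)" if "X \<in> T" for X
    using p_nonneg[OF that] by simp
  have "0 < F"
    using q D(1) by (simp add: F_def)
  have F: "real F = of_int q * real D"
    using q by (simp add: F_def)
  have "length L = (\<Sum>X\<in>T. nat (p X))"
    by (simp add: L_def length_concat comp_def sum_list_distinct_conv_sum_set Xs)
  then have "real (length L) = real F"
    using exact[of T] T(4) real_p by (simp add: F)
  then have len: "length L = F" by simp
  have "real (card {k. k < F \<and> v \<in> L ! k}) = x v * real F" for v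
  proof -
    have "x v = sum c {X\<in>T. v \<in> X}"
      unfolding xT sum.inter_filter[OF T(1)] by (intro sum.cong) (auto simp: incidence_def)
    moreover have "card {k. k < F \<and> v \<in> L ! k} = (\<Sum>X\<in>{X\<in>T. v \<in> X}. nat (p X))"
      using card_nth_concat_replicate[of "\<lambda>X. nat (p X)" Xs v]
      by (simp add: L_def[symmetric] len sum_list_distinct_conv_sum_set Xs sum.inter_filter[OF T(1)])
    ultimately show ?thesis
      using exact[of "{X\<in>T. v \<in> X}"] Dx[of v] real_p by (simp add: F)
  qed
  moreover have "stable_set V adj (L ! k)" if "k < F" for k
  proof -
    have "L ! k \<in> set L" using that len by simp
    then have "L ! k \<in> T" by (auto simp: L_def Xs)
    then show ?thesis using T(2) by blast
  qed
  ultimately show ?thesis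
    using \<open>0 < F\<close> by (intro exI[of _ F] exI[of _ "(!) L"]) blast
qed

section \<open>Linear spans and a dimension bound by counting\<close>

lemma in_span_mono: "in_span R X y \<Longrightarrow> X \<subseteq> Y \<Longrightarrow> in_span R Y y"
  unfolding in_span_def by (elim exE conjE, intro exI conjI) (assumption | erule (1) order_trans)+

text \<open>Padding with zero coefficients replaces the arbitrary finite subset in
  \<open>in_span\<close> by the fixed index set \<open>X\<close>, so that combinations can be added
  coefficientwise.\<close>

lemma in_span_iff:
  fixes R :: "nat ring" (structure)
  assumes "ring R" "finite X" and X: "\<And>v k. v \<in> X \<Longrightarrow> v k \<in> carrier R"
  shows "in_span R X y \<longleftrightarrow> (\<exists>c\<in>X \<rightarrow> carrier R. y = (\<lambda>k. \<Oplus>v\<in>X. c v \<otimes> v k))"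
proof
  interpret ring R by fact
  assume "in_span R X y"
  then obtain S c where S: "finite S" "S \<subseteq> X" "\<forall>v\<in>S. c v \<in> carrier R"
    and y: "y = (\<lambda>k. \<Oplus>v\<in>S. c v \<otimes> v k)"
    unfolding in_span_def by blast
  let ?c = "\<lambda>v. if v \<in> S then c v else \<zero>"
  have "(\<Oplus>v\<in>S. c v \<otimes> v k) = (\<Oplus>v\<in>X. ?c v \<otimes> v k)" for k
    using S X \<open>finite X\<close> by (intro add.finprod_mono_neutral_cong_left) auto
  then show "\<exists>c\<in>X \<rightarrow> carrier R. y = (\<lambda>k. \<Oplus>v\<in>X. c v \<otimes> v k)"
    using S(3) y by (intro bexI[of _ ?c]) auto
next
  assume "\<exists>c\<in>X \<rightarrow> carrier R. y = (\<lambda>k. \<Oplus>v\<in>X. c v \<otimes> v k)"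
  then obtain c where "c \<in> X \<rightarrow> carrier R" "y = (\<lambda>k. \<Oplus>v\<in>X. c v \<otimes> v k)"
    by blast
  then show "in_span R X y"
    unfolding in_span_def using \<open>finite X\<close> by (intro exI[of _ X] exI[of _ c] conjI) auto
qed

locale span_ring = ring R for R :: "nat ring" (structure) +
  fixes X :: "(nat \<Rightarrow> nat) set"
  assumes finite_X: "finite X"
    and X_carrier [simp]: "\<And>v k. v \<in> X \<Longrightarrow> v k \<in> carrier R"
begin

lemma in_span_iff':
  "in_span R X y \<longleftrightarrow> (\<exists>c\<in>X \<rightarrow> carrier R. y = (\<lambda>k. \<Oplus>v\<in>X. c v \<otimes> v k))"
  by (rule in_span_iff[OF ring_axioms finite_X]) simp

lemma in_span_carrier: "in_span R X y \<Longrightarrow> y k \<in> carrier R"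
  by (auto simp: in_span_iff' intro!: finsum_closed)

lemma in_span_base:
  assumes "v \<in> X" shows "in_span R X v"
  unfolding in_span_def
proof (intro exI conjI)
  show "v = (\<lambda>k. \<Oplus>w\<in>{v}. \<one> \<otimes> w k)"
    using assms by (auto simp: fun_eq_iff)
qed (use assms in auto)

lemma in_span_zero: "in_span R X (\<lambda>_. \<zero>)"
  unfolding in_span_def by (intro exI[of _ "{}"]) auto

lemma in_span_add:
  assumes "in_span R X y" "in_span R X z"
  shows "in_span R X (\<lambda>k. y k \<oplus> z k)"
proof -
  obtain c d where c: "c \<in> X \<rightarrow> carrier R" "y = (\<lambda>k. \<Oplus>v\<in>X. c v \<otimes> v k)"
    and d: "d \<in> X \<rightarrow> carrier R" "z = (\<lambda>k. \<Oplus>v\<in>X. d v \<otimes> v k)"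
    using assms unfolding in_span_iff' by blast
  have "y k \<oplus> z k = (\<Oplus>v\<in>X. (c v \<oplus> d v) \<otimes> v k)" for k
  proof -
    have "(\<Oplus>v\<in>X. (c v \<oplus> d v) \<otimes> v k) = (\<Oplus>v\<in>X. c v \<otimes> v k \<oplus> d v \<otimes> v k)"
      using c(1) d(1) by (intro finsum_cong') (auto simp: l_distr Pi_iff)
    also have "\<dots> = y k \<oplus> z k"
      unfolding c(2) d(2) using c(1) d(1) by (intro finsum_addf) auto
    finally show ?thesis by simp
  qed
  then show ?thesis
    unfolding in_span_iff' using c(1) d(1)
    by (intro bexI[of _ "\<lambda>v. c v \<oplus> d v"]) auto
qed

lemma in_span_smult:
  assumes "a \<in> carrier R" "in_span R X y"
  shows "in_span R X (\<lambda>k. a \<otimes> y k)"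
proof -
  obtain c where c: "c \<in> X \<rightarrow> carrier R" "y = (\<lambda>k. \<Oplus>v\<in>X. c v \<otimes> v k)"
    using assms unfolding in_span_iff' by blast
  have "a \<otimes> y k = (\<Oplus>v\<in>X. (a \<otimes> c v) \<otimes> v k)" for k
  proof -
    have "(\<Oplus>v\<in>X. (a \<otimes> c v) \<otimes> v k) = (\<Oplus>v\<in>X. a \<otimes> (c v \<otimes> v k))"
      using c(1) assms(1) by (intro finsum_cong') (auto simp: m_assoc Pi_iff)
    also have "\<dots> = a \<otimes> y k"
      unfolding c(2) using c(1) assms(1) finite_X by (intro finsum_rdistr[symmetric]) auto
    finally show ?thesis by simp
  qed
  then show ?thesis
    unfolding in_span_iff' using c(1) assms(1)
    by (intro bexI[of _ "\<lambda>v. a \<otimes> c v"]) auto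
qed

lemma in_span_finsum:
  assumes "finite S" "\<And>s. s \<in> S \<Longrightarrow> a s \<in> carrier R" "\<And>s. s \<in> S \<Longrightarrow> in_span R X (f s)"
  shows "in_span R X (\<lambda>k. \<Oplus>s\<in>S. a s \<otimes> f s k)"
  using assms
proof (induction S rule: finite_induct)
  case empty
  then show ?case by (simp add: in_span_zero)
next
  case (insert s S)
  have "(\<Oplus>s\<in>insert s S. a s \<otimes> f s k) = a s \<otimes> f s k \<oplus> (\<Oplus>s\<in>S. a s \<otimes> f s k)" for k
    using insert in_span_carrier by (intro finsum_insert) auto
  then show ?case
    using insert by (auto intro!: in_span_add in_span_smult)
qed

lemma in_span_trans:
  assumes "in_span R Y y" "\<And>v. v \<in> Y \<Longrightarrow> in_span R X v"
  shows "in_span R X y"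
proof -
  obtain S c where S: "finite S" "S \<subseteq> Y" "\<forall>v\<in>S. c v \<in> carrier R"
    and y: "y = (\<lambda>k. \<Oplus>v\<in>S. c v \<otimes> v k)"
    using assms(1) unfolding in_span_def by blast
  show ?thesis
    unfolding y using S assms(2) by (intro in_span_finsum) auto
qed

end

lemma finsum_unit_vec:
  fixes R :: "nat ring" (structure)
  assumes "ring R" "finite S" "\<And>m. m \<in> S \<Longrightarrow> a m \<in> carrier R"
  shows "(\<Oplus>m\<in>S. a m \<otimes> unit_vec R m k) = (if k \<in> S then a k else \<zero>)"
proof -
  interpret ring R by fact
  have "(\<Oplus>m\<in>S. a m \<otimes> unit_vec R m k) = (\<Oplus>m\<in>S. if k = m then a m else \<zero>)"
    using assms(3) by (intro finsum_cong') (auto simp: unit_vec_def)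
  also have "\<dots> = (if k \<in> S then a k else \<zero>)"
    using assms(2,3) by (auto intro: add.finprod_singleton add.finprod_one_eqI)
  finally show ?thesis .
qed

text \<open>Counting replaces dimension theory: every vector on the first \<open>M\<close>
  coordinates is a combination of \<open>X\<close>, so the field size to the power \<open>M\<close>
  is at most the field size to the power \<open>card X\<close>, and a field has at least two
  elements.\<close>

lemma unit_vecs_in_span_card_le:
  fixes R :: "nat ring" (structure)
  assumes "field R" "finite (carrier R)" "finite X"
    and X: "\<And>v k. v \<in> X \<Longrightarrow> v k \<in> carrier R"
    and span: "\<And>m. m < M \<Longrightarrow> in_span R X (unit_vec R m)"
  shows "M \<le> card X"
proof -
  interpret field R by fact
  interpret span_ring R X
    using assms by unfold_locales auto
  \<comment> \<open>Coefficients and results are both taken as extensional functions, so that each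
    side of the inclusion is a finite set of known size.\<close>
  let ?\<Phi> = "\<lambda>c. restrict (\<lambda>k. \<Oplus>v\<in>X. c v \<otimes> v k) {..<M}"
  have sub: "({..<M} \<rightarrow>\<^sub>E carrier R) \<subseteq> ?\<Phi> ` (X \<rightarrow>\<^sub>E carrier R)"
  proof
    fix y assume y: "y \<in> {..<M} \<rightarrow>\<^sub>E carrier R"
    have "in_span R X (\<lambda>k. \<Oplus>m\<in>{..<M}. y m \<otimes> unit_vec R m k)"
      using y span by (intro in_span_finsum) auto
    then obtain c where c: "c \<in> X \<rightarrow> carrier R"
      and eq: "(\<lambda>k. \<Oplus>m\<in>{..<M}. y m \<otimes> unit_vec R m k) = (\<lambda>k. \<Oplus>v\<in>X. c v \<otimes> v k)"
      unfolding in_span_iff' by blast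
    have "y k = (\<Oplus>v\<in>X. restrict c X v \<otimes> v k)" if "k < M" for k
    proof -
      have "(\<Oplus>v\<in>X. restrict c X v \<otimes> v k) = (\<Oplus>v\<in>X. c v \<otimes> v k)"
        using c by (intro finsum_cong') auto
      also have "\<dots> = (\<Oplus>m\<in>{..<M}. y m \<otimes> unit_vec R m k)"
        using fun_cong[OF eq, of k] by simp
      also have "\<dots> = y k"
        using y that finsum_unit_vec[OF ring_axioms, of "{..<M}" y k] by auto
      finally show ?thesis by simp
    qed
    then have "y k = ?\<Phi> (restrict c X) k" for k
      using PiE_arb[OF y, of k] by (cases "k < M") (simp_all del: restrict_apply add: restrict_def)
    then have "y = ?\<Phi> (restrict c X)"
      by (rule ext)
    then show "y \<in> ?\<Phi> ` (X \<rightarrow>\<^sub>E carrier R)"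
      using c by (intro image_eqI[of y ?\<Phi> "restrict c X"]) auto
  qed
  have "finite (X \<rightarrow>\<^sub>E carrier R)"
    using assms by (intro finite_PiE) auto
  then have "card ({..<M} \<rightarrow>\<^sub>E carrier R) \<le> card (X \<rightarrow>\<^sub>E carrier R)"
    using sub by (rule surj_card_le)
  then have "card (carrier R) ^ M \<le> card (carrier R) ^ card X"
    using \<open>finite X\<close> by (simp add: card_PiE)
  moreover have "1 < card (carrier R)"
  proof -
    have "card {\<zero>, \<one>} \<le> card (carrier R)"
      using assms(2) by (intro card_mono) auto
    then show ?thesis by simp
  qed
  ultimately show ?thesis
    by simp
qed

section \<open>Vandermonde systems and arbitrarily large finite fields\<close>

text \<open>Induction on the evaluation points. Passing from \<open>y i\<close> to
  \<open>y (Suc i) \<ominus> \<alpha> b \<otimes> y i\<close> annihilates the powers of the new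
  point \<open>\<alpha> b\<close>, which leaves a system in the old points with one equation
  fewer.\<close>

lemma (in field) vandermonde_solvable:
  assumes "finite A" "inj_on \<alpha> A" "\<And>k. k \<in> A \<Longrightarrow> \<alpha> k \<in> carrier R" "\<And>i. y i \<in> carrier R"
  shows "\<exists>c\<in>A \<rightarrow> carrier R. \<forall>i<card A. (\<Oplus>k\<in>A. c k \<otimes> \<alpha> k [^] i) = y i"
  using assms
proof (induction A arbitrary: y rule: finite_induct)
  case empty
  then show ?case by auto
next
  case (insert b A)
  note [simp] = insert.prems(2,3)
  have \<alpha>b [simp]: "\<alpha> b \<in> carrier R" by simp
  have nz: "\<alpha> k \<ominus> \<alpha> b \<in> carrier R - {\<zero>}" if "k \<in> A" for k
    using that insert.prems(1) insert.hyps by (auto simp: inj_on_def)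
  obtain c where c: "c \<in> A \<rightarrow> carrier R"
    and c_sum: "\<forall>i<card A. (\<Oplus>k\<in>A. c k \<otimes> \<alpha> k [^] i) = y (Suc i) \<ominus> \<alpha> b \<otimes> y i"
    using insert.IH[of "\<lambda>i. y (Suc i) \<ominus> \<alpha> b \<otimes> y i"] insert.prems by (auto simp: inj_on_def)
  \<comment> \<open>The difference operator multiplies the coefficient at \<open>\<alpha> k\<close>
    by \<open>\<alpha> k \<ominus> \<alpha> b\<close>. Dividing by this factor undoes it.\<close>
  define d where "d k = c k \<otimes> inv (\<alpha> k \<ominus> \<alpha> b)" for k
  have d [simp]: "d k \<in> carrier R" if "k \<in> A" for k
    using c nz[OF that] that by (auto simp: d_def field_Units)
  have dc: "d k \<otimes> (\<alpha> k \<ominus> \<alpha> b) = c k" if "k \<in> A" for k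
    using c nz[OF that] that by (simp add: d_def m_assoc field_Units Pi_iff)
  define z where "z i = (\<Oplus>k\<in>A. d k \<otimes> \<alpha> k [^] (i::nat))" for i
  have z [simp]: "z i \<in> carrier R" for i
    unfolding z_def by (intro finsum_closed) auto
  have z_Suc: "z (Suc i) = (y (Suc i) \<ominus> \<alpha> b \<otimes> y i) \<oplus> \<alpha> b \<otimes> z i" if "i < card A" for i
  proof -
    have "d k \<otimes> \<alpha> k [^] Suc i = c k \<otimes> \<alpha> k [^] i \<oplus> \<alpha> b \<otimes> (d k \<otimes> \<alpha> k [^] i)" if "k \<in> A" for k
    proof -
      have "c k \<otimes> \<alpha> k [^] i = d k \<otimes> (\<alpha> k \<ominus> \<alpha> b) \<otimes> \<alpha> k [^] i"
        using dc[OF that] by simp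
      also have "\<dots> = d k \<otimes> \<alpha> k [^] Suc i \<ominus> \<alpha> b \<otimes> (d k \<otimes> \<alpha> k [^] i)"
        using that by (simp add: minus_eq l_distr r_distr m_ac l_minus r_minus)
      finally show ?thesis
        using that by (simp add: minus_eq a_assoc l_neg)
    qed
    then have "z (Suc i) = (\<Oplus>k\<in>A. c k \<otimes> \<alpha> k [^] i \<oplus> \<alpha> b \<otimes> (d k \<otimes> \<alpha> k [^] i))"
      unfolding z_def using c by (intro finsum_cong') (auto simp: Pi_iff)
    also have "\<dots> = (\<Oplus>k\<in>A. c k \<otimes> \<alpha> k [^] i) \<oplus> (\<Oplus>k\<in>A. \<alpha> b \<otimes> (d k \<otimes> \<alpha> k [^] i))"
      using c by (intro finsum_addf) auto
    also have "(\<Oplus>k\<in>A. \<alpha> b \<otimes> (d k \<otimes> \<alpha> k [^] i)) = \<alpha> b \<otimes> z i"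
      unfolding z_def using insert.hyps(1) by (intro finsum_rdistr[symmetric]) auto
    finally show ?thesis
      using c_sum that by simp
  qed
  \<comment> \<open>Up to index \<open>card A\<close>, \<open>y\<close> and \<open>z\<close> obey
    the same recurrence, so their difference is geometric with ratio \<open>\<alpha> b\<close>. Its
    initial value is the coefficient still missing at \<open>b\<close>.\<close>
  define e where "e k = (if k = b then y 0 \<ominus> z 0 else d k)" for k
  have e: "e \<in> insert b A \<rightarrow> carrier R"
    by (auto simp: e_def)
  have e_sum: "(\<Oplus>k\<in>insert b A. e k \<otimes> \<alpha> k [^] i) = (y 0 \<ominus> z 0) \<otimes> \<alpha> b [^] i \<oplus> z i" for i :: nat
  proof -
    have "(\<Oplus>k\<in>A. e k \<otimes> \<alpha> k [^] i) = z i"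
      unfolding z_def using insert.hyps by (intro finsum_cong') (auto simp: e_def)
    then show ?thesis
      using insert.hyps e by (subst finsum_insert) (auto simp: e_def)
  qed
  have "(y 0 \<ominus> z 0) \<otimes> \<alpha> b [^] i \<oplus> z i = y i" if "i < card (insert b A)" for i
    using that
  proof (induction i)
    case 0
    show ?case by (simp add: minus_eq a_assoc l_neg)
  next
    case (Suc i)
    then have i: "i < card A" using insert.hyps by simp
    have "(y 0 \<ominus> z 0) \<otimes> \<alpha> b [^] Suc i \<oplus> z (Suc i)
        = \<alpha> b \<otimes> ((y 0 \<ominus> z 0) \<otimes> \<alpha> b [^] i \<oplus> z i) \<oplus> (y (Suc i) \<ominus> \<alpha> b \<otimes> y i)"
    proof -
      have "u \<otimes> (P \<otimes> a) \<oplus> (w \<oplus> a \<otimes> v) = a \<otimes> (u \<otimes> P \<oplus> v) \<oplus> w"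
        if "u \<in> carrier R" "P \<in> carrier R" "a \<in> carrier R" "v \<in> carrier R" "w \<in> carrier R"
        for u P a v w
        using that by (simp add: r_distr m_ac a_ac)
      then show ?thesis
        unfolding z_Suc[OF i] nat_pow_Suc by simp
    qed
    also have "\<dots> = \<alpha> b \<otimes> y i \<oplus> (y (Suc i) \<ominus> \<alpha> b \<otimes> y i)"
      using Suc by simp
    also have "\<dots> = y (Suc i)"
      by (simp add: minus_eq a_lcomm r_neg)
    finally show ?case .
  qed
  then show ?case
    using e e_sum by (intro bexI[of _ e]) auto
qed

text \<open>The residue field modulo a prime above \<open>n\<close> lives on integers. The map
  \<open>nat\<close> is injective on its representatives and transports it to the carrier type of
  coding schemes.\<close>

lemma finite_field_nat_exists:
  obtains R :: "nat ring" where "field R" "finite (carrier R)" "n \<le> card (carrier R)"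
proof -
  obtain p :: nat where p: "prime p" "n < p"
    using bigger_prime by blast
  define Q where "Q = residue_ring (int p)"
  interpret residues_prime p Q
    using p by unfold_locales (auto simp: Q_def)
  have carrier: "carrier Q = {0..int p - 1}"
    by (rule res_carrier_eq)
  have inj: "inj_on nat (carrier Q)"
    by (auto simp: carrier inj_on_def)
  have "card (carrier Q) = p"
    by (simp add: carrier)
  then show ?thesis
    using that[of "image_ring nat Q"] inj_imp_image_ring_is_field[OF inj] p(2) inj
    by (simp add: image_ring_carrier carrier card_image)
qed

section \<open>Monotonicity and causality of reception and queues\<close>

lemma arrived_mono: "s \<le> t \<Longrightarrow> arrived a s i J \<le> arrived a t i J"
  unfolding arrived_def by (intro sum_mono2) auto

lemma received_mono: "s \<le> t \<Longrightarrow> received sched F code a s i J j \<subseteq> received sched F code a t i J j"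
  unfolding received_def by (blast intro: less_le_trans)

lemma finite_received: "finite (received sched F code a t i J j)"
proof -
  have "received sched F code a t i J j \<subseteq> (\<lambda>s. code a s i) ` {..<t}"
    unfolding received_def by blast
  then show ?thesis
    by (rule finite_subset) simp
qed

text \<open>A queue depends only on the past. The two codes may differ as functions of the arrival
  process, so that a partial record of sent packets can stand in for a code.\<close>

lemma queue_cong:
  assumes "\<And>s. s < t \<Longrightarrow> a s = a' s" "\<And>s. s < t \<Longrightarrow> code a s = code' a' s"
  shows "queue R sched F code a t i J = queue R sched F code' a' t i J"
proof -
  have "arrived a t i J = arrived a' t i J"
    unfolding arrived_def using assms(1) by simp
  moreover have "received sched F code a t i J j = received sched F code' a' t i J j" for j
    unfolding received_def using assms(2) by metis
  ultimately show ?thesis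
    by (simp add: queue_def served_def)
qed

section \<open>From a frame guarantee to the stable set polytope\<close>

definition slot_stable :: "config \<Rightarrow> subflow set" where
  "slot_stable c = {(i, J, j). \<exists>D. c i = Some (J, D) \<and> j \<in> D}"

text \<open>An input serves only one flow per slot, which excludes adjacency through a common input;
  disjoint connections exclude adjacency through a common output.\<close>

lemma stable_set_slot_stable:
  assumes "valid_config K N c"
  shows "stable_set (subflows K N) enh_adj (slot_stable c)"
  unfolding stable_set_def
proof (intro conjI ballI)
  show "slot_stable c \<subseteq> subflows K N"
    using assms unfolding slot_stable_def subflows_def valid_config_def by blast
next
  fix v w assume vw: "v \<in> slot_stable c" "w \<in> slot_stable c"
  obtain i J j i' J' j' where [simp]: "v = (i, J, j)" "w = (i', J', j')"
    by (metis prod_cases3)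
  obtain D D' where D: "c i = Some (J, D)" "j \<in> D" and D': "c i' = Some (J', D')" "j' \<in> D'"
    using vw by (auto simp: slot_stable_def)
  show "\<not> enh_adj v w"
  proof (cases "i = i'")
    case True
    then show ?thesis using D D' by (auto simp: enh_adj_def)
  next
    case False
    then have "D \<inter> D' = {}"
      using assms D D' unfolding valid_config_def by blast
    then show ?thesis using False D D' by (auto simp: enh_adj_def)
  qed
qed

lemma stable_set_subset: "stable_set V adj S \<Longrightarrow> S' \<subseteq> S \<Longrightarrow> stable_set V adj S'"
  unfolding stable_set_def by blast

text \<open>All packets arrive in the last slot of the first frame, so everything sent during that frame
is the zero vector and only the slots of the second frame can contribute to decoding.\<close>

lemma guarantee_slots_le:
  fixes R :: "nat ring" (structure)
  assumes "field R" "finite (carrier R)" "0 < F" and valid: "valid_code R sched F code"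
    and guarantee: "frame_guarantee R K N r F sched code"
    and flow: "is_flow K N i J" "j \<in> J" and M: "r i J * real F = real M"
  shows "M \<le> card {k. k < F \<and> (i, J, j) \<in> slot_stable (sched k)}"
proof -
  interpret field R by fact
  \<comment> \<open>Arrivals count only from the next slot on, so slot \<open>F - 1\<close> fills
    the queue exactly at the end of the first frame and leaves it empty until then.\<close>
  define a :: arrivals where "a = (\<lambda>s i J. if s = F - 1 then M else 0)"
  have arrived: "arrived a t i J = (if t < F then 0 else M)" for t
    using \<open>0 < F\<close> by (auto simp: arrived_def a_def)
  have code_carrier: "code a s i k \<in> carrier R"
    and code_support: "code a s i k \<noteq> \<zero> \<Longrightarrow> k \<in> queue R sched F code a s i J"
    if "sched (s mod F) i = Some (J, D)" for s D k
    using valid that unfolding valid_code_def by blast+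
  have code_zero: "code a s i = (\<lambda>_. \<zero>)" if "sched (s mod F) i = Some (J, D)" "s < F" for s D
    using code_support[OF that(1)] that(2) by (auto simp: queue_def arrived)
  \<comment> \<open>Zero vectors span no unit vector. Hence all \<open>M\<close> packets are still
    queued when the second frame starts, and each has fewer than \<open>M\<close> older
    ones.\<close>
  have not_served: "\<not> served R sched F code a F i J m" for m
  proof
    assume "served R sched F code a F i J m"
    then have span: "in_span R (received sched F code a F i J j) (unit_vec R m)"
      using flow(2) by (auto simp: served_def)
    have zeros: "v = (\<lambda>_. \<zero>)" if "v \<in> received sched F code a F i J j" for v
      using that code_zero by (auto simp: received_def)
    interpret span_ring R "{}"
      by unfold_locales auto
    have "in_span R {} (unit_vec R m)"
      by (rule in_span_trans[OF span]) (drule zeros, simp add: in_span_zero)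
    then have "unit_vec R m = (\<lambda>_. \<zero>)"
      by (auto simp: in_span_def)
    then show False
      by (metis unit_vec_def one_not_zero)
  qed
  have queue: "queue R sched F code a F i J = {..<M}"
    using not_served by (auto simp: queue_def arrived)
  have served: "served R sched F code a (2 * F) i J m" if "m < M" for m
  proof -
    have "{m' \<in> {..<M}. m' < m} = {..<m}" using that by auto
    then show ?thesis
      using guarantee flow(1) that M queue unfolding frame_guarantee_def
      by (elim allE[of _ a] allE[of _ 2] allE[of _ i] allE[of _ J]) simp
  qed
  define A where "A = {k. k < F \<and> (i, J, j) \<in> slot_stable (sched k)}"
  \<comment> \<open>Indexing the vectors by listening slots of the second frame bounds
    \<open>card X\<close> by \<open>card A\<close>, even if some slots carry equal vectors.\<close>
  define X where "X = (\<lambda>k. code a (F + k) i) ` A"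
  have A: "\<exists>D. sched k i = Some (J, D) \<and> j \<in> D" if "k \<in> A" for k
    using that by (auto simp: A_def slot_stable_def)
  have finA: "finite A" by (simp add: A_def)
  have X_carrier: "v k \<in> carrier R" if v: "v \<in> X" for v k
  proof -
    obtain l where l: "l \<in> A" "v = code a (F + l) i" using v by (auto simp: X_def)
    then have "(F + l) mod F = l" by (simp add: A_def)
    then show ?thesis using A[OF l(1)] code_carrier l(2) by metis
  qed
  interpret span_ring R X
    using finA X_carrier by unfold_locales (auto simp: X_def)
  have "in_span R X (unit_vec R m)" if "m < M" for m
  proof (rule in_span_trans)
    show "in_span R (received sched F code a (2 * F) i J j) (unit_vec R m)"
      using served[OF that] flow(2) by (auto simp: served_def)
    fix v assume "v \<in> received sched F code a (2 * F) i J j"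
    then obtain s D where s: "v = code a s i" "s < 2 * F" "sched (s mod F) i = Some (J, D)" "j \<in> D"
      by (auto simp: received_def)
    show "in_span R X v"
    proof (cases "s < F")
      case True
      then show ?thesis using code_zero s in_span_zero by simp
    next
      case False
      then have "s mod F = s - F"
        using s(2) by (simp add: mod_if)
      then have "s - F \<in> A"
        using False s by (auto simp: A_def slot_stable_def)
      then have "v \<in> X"
        using False s(1) unfolding X_def by (intro image_eqI[of _ _ "s - F"]) auto
      then show ?thesis by (rule in_span_base)
    qed
  qed
  then have "M \<le> card X"
    using assms(1,2) finite_X X_carrier by (intro unit_vecs_in_span_card_le) auto
  also have "\<dots> \<le> card A"
    unfolding X_def using finA by (rule card_image_le)
  finally show ?thesis unfolding A_def .
qed

lemma STAB_if_guarantee: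
  fixes R :: "nat ring"
  assumes "field R" "finite (carrier R)" "0 < F"
    and config: "\<forall>k<F. valid_config K N (sched k)"
    and valid: "valid_code R sched F code"
    and int: "\<forall>i J. is_flow K N i J \<longrightarrow> r i J * real F \<in> \<nat>"
    and guarantee: "frame_guarantee R K N r F sched code"
  shows "enhanced K N r \<in> STAB (subflows K N) enh_adj"
proof -
  \<comment> \<open>An output may listen more often than needed, while \<open>STAB_slotsI\<close>
    asks for exact counts; each subflow therefore keeps only as many slots as its rate
    requires.\<close>
  have "\<exists>C. C \<subseteq> {k. k < F \<and> v \<in> slot_stable (sched k)} \<and> real (card C) = enhanced K N r v * real F"
    for v
  proof (cases "v \<in> subflows K N")
    case True
    obtain i J j where v: "v = (i, J, j)" by (metis prod_cases3)
    have flow: "is_flow K N i J" "j \<in> J"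
      using True by (auto simp: v subflows_def)
    have "r i J * real F \<in> \<nat>"
      using int flow(1) by blast
    then obtain M where M: "r i J * real F = real M"
      by (rule Nats_cases)
    have "M \<le> card {k. k < F \<and> v \<in> slot_stable (sched k)}"
      unfolding v by (rule guarantee_slots_le[OF assms(1-3) valid guarantee flow M])
    then obtain C where "C \<subseteq> {k. k < F \<and> v \<in> slot_stable (sched k)}" "card C = M"
      by (rule obtain_subset_with_card_n)
    then show ?thesis
      using True M by (auto simp: enhanced_def v)
  next
    case False
    then show ?thesis by (intro exI[of _ "{}"]) (cases v, auto simp: enhanced_def)
  qed
  then have "\<exists>C. \<forall>v. C v \<subseteq> {k. k < F \<and> v \<in> slot_stable (sched k)} \<and>
      real (card (C v)) = enhanced K N r v * real F"
    by (intro choice allI)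
  then obtain C where C: "\<And>v. C v \<subseteq> {k. k < F \<and> v \<in> slot_stable (sched k)}"
    "\<And>v. real (card (C v)) = enhanced K N r v * real F"
    by blast
  \<comment> \<open>The slots kept for different subflows need no coordination, since any selection
    within one slot is a subset of a stable set.\<close>
  have "stable_set (subflows K N) enh_adj {v. k \<in> C v}" if "k < F" for k
    using C(1) config that by (intro stable_set_subset[OF stable_set_slot_stable]) auto
  moreover have "{k. k < F \<and> v \<in> {v. k \<in> C v}} = C v" for v
    using C(1)[of v] by blast
  ultimately show ?thesis
    using C(2) \<open>0 < F\<close> by (intro STAB_slotsI[of F _ _ "\<lambda>k. {v. k \<in> C v}"]) auto
qed

section \<open>The Vandermonde coding scheme and its decoding\<close>

text \<open>The oldest packet of \<open>Q\<close> has rank 0. Ranks serve both as the age test of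
  the guarantee and as Vandermonde exponents.\<close>

definition queue_rank :: "nat set \<Rightarrow> nat \<Rightarrow> nat" where
  "queue_rank Q x = card {y \<in> Q. y < x}"

lemma inj_on_rank: "inj_on (queue_rank Q) Q"
proof (rule linorder_inj_onI')
  fix x y assume "x \<in> Q" "y \<in> Q" "x < y"
  then have "{z \<in> Q. z < x} \<subset> {z \<in> Q. z < y}"
    by (auto intro: less_trans)
  then have "queue_rank Q x < queue_rank Q y"
    unfolding queue_rank_def by (intro psubset_card_mono) auto
  then show "queue_rank Q x \<noteq> queue_rank Q y" by simp
qed

text \<open>The current queue depends on what was sent before, so the code is built by recursion on
  slots: \<open>w\<close> records the packets sent under \<open>a\<close>, and the constant function
  \<open>\<lambda>_. w\<close> gives it the type of a coding scheme. Ranks refer to the queue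
  \<open>Q\<close> at the start of the frame and stay fixed within it; membership in the current
  queue keeps the code valid.\<close>

definition vandermonde_step ::
  "nat ring \<Rightarrow> (nat \<Rightarrow> nat) \<Rightarrow> (nat \<Rightarrow> nat set \<Rightarrow> real) \<Rightarrow> nat \<Rightarrow> (nat \<Rightarrow> config) \<Rightarrow> arrivals
    \<Rightarrow> (nat \<Rightarrow> nat \<Rightarrow> nat \<Rightarrow> nat) \<Rightarrow> nat \<Rightarrow> nat \<Rightarrow> nat \<Rightarrow> nat" where
  "vandermonde_step R \<alpha> r F sched a w t i = (case sched (t mod F) i of
      None \<Rightarrow> (\<lambda>_. \<zero>\<^bsub>R\<^esub>)
    | Some (J, D) \<Rightarrow>
        (let Q = queue R sched F (\<lambda>_. w) a (t div F * F) i J in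
         (\<lambda>x. if x \<in> queue R sched F (\<lambda>_. w) a t i J \<and> x \<in> Q \<and> real (queue_rank Q x) < r i J * real F
              then \<alpha> (t mod F) [^]\<^bsub>R\<^esub> queue_rank Q x else \<zero>\<^bsub>R\<^esub>)))"

definition vandermonde_code ::
  "nat ring \<Rightarrow> (nat \<Rightarrow> nat) \<Rightarrow> (nat \<Rightarrow> nat set \<Rightarrow> real) \<Rightarrow> nat \<Rightarrow> (nat \<Rightarrow> config) \<Rightarrow> coding" where
  "vandermonde_code R \<alpha> r F sched a = wfrec less_than (vandermonde_step R \<alpha> r F sched a)"

text \<open>Both queues are read at times up to \<open>t\<close>, hence see only earlier slots. This
  makes the recursion admissible and, for two arrival processes, the code causal.\<close>

lemma vandermonde_step_cong:
  assumes "\<And>s. s < t \<Longrightarrow> a s = a' s" "\<And>s. s < t \<Longrightarrow> w s = w' s"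
  shows "vandermonde_step R \<alpha> r F sched a w t = vandermonde_step R \<alpha> r F sched a' w' t"
proof -
  have "s < t" if "s < t div F * F" for s
    using that div_times_less_eq_dividend[of t F] by linarith
  then have "queue R sched F (\<lambda>_. w) a (t div F * F) i J = queue R sched F (\<lambda>_. w') a' (t div F * F) i J" for i J
    using assms by (intro queue_cong) auto
  moreover have "queue R sched F (\<lambda>_. w) a t i J = queue R sched F (\<lambda>_. w') a' t i J" for i J
    using assms by (intro queue_cong) auto
  ultimately show ?thesis
    unfolding vandermonde_step_def by presburger
qed

lemma vandermonde_code_unfold:
  "vandermonde_code R \<alpha> r F sched a t
     = vandermonde_step R \<alpha> r F sched a (vandermonde_code R \<alpha> r F sched a) t"
proof -
  have "adm_wf less_than (vandermonde_step R \<alpha> r F sched a)"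
    unfolding adm_wf_def by (auto intro: vandermonde_step_cong)
  then show ?thesis
    unfolding vandermonde_code_def by (metis wfrec_fixpoint wf_less_than)
qed

lemma vandermonde_code_eq:
  fixes R :: "nat ring" (structure) and r F sched \<alpha>
  defines "code \<equiv> vandermonde_code R \<alpha> r F sched"
  assumes "sched (t mod F) i = Some (J, D)" and "Q = queue R sched F code a (t div F * F) i J"
  shows "code a t i = (\<lambda>x. if x \<in> queue R sched F code a t i J \<and> x \<in> Q \<and> real (queue_rank Q x) < r i J * real F
              then \<alpha> (t mod F) [^] queue_rank Q x else \<zero>)"
proof -
  have "queue R sched F (\<lambda>_. code a) a = queue R sched F code a"
    by (intro ext queue_cong) auto
  then show ?thesis
    unfolding assms(3) code_def using assms(2) vandermonde_code_unfold[of R \<alpha> r F sched a t]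
    by (simp add: vandermonde_step_def Let_def)
qed

lemma valid_vandermonde_code:
  fixes R :: "nat ring"
  assumes "field R" "\<And>k. \<alpha> k \<in> carrier R"
  shows "valid_code R sched F (vandermonde_code R \<alpha> r F sched)"
  unfolding valid_code_def
proof (intro conjI allI impI)
  interpret field R by fact
  let ?code = "vandermonde_code R \<alpha> r F sched"
  fix a t i J D k assume sched: "sched (t mod F) i = Some (J, D)"
  show "?code a t i k \<in> carrier R"
    unfolding vandermonde_code_eq[where sched = sched and t = t and F = F, OF sched refl] using assms(2) by auto
  show "{k. ?code a t i k \<noteq> \<zero>\<^bsub>R\<^esub>} \<subseteq> queue R sched F ?code a t i J"
    unfolding vandermonde_code_eq[where sched = sched and t = t and F = F, OF sched refl] by auto
next
  let ?code = "vandermonde_code R \<alpha> r F sched"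
  fix a a' :: arrivals and t
  assume "\<forall>s<t. a s = a' s"
  then show "?code a t = ?code a' t"
  proof (induction t rule: less_induct)
    case (less t)
    then show ?case
      unfolding vandermonde_code_unfold[of _ _ _ _ _ _ t]
      by (intro vandermonde_step_cong) auto
  qed
qed

text \<open>In each listening slot an output recovers a full Vandermonde row. Since it listens in
  \<open>r i J * F\<close> slots and the ranks concerned lie below this number, the rows can be
  combined into each required unit vector.\<close>

lemma vandermonde_guarantee:
  fixes R :: "nat ring" (structure) and r F sched \<alpha>
  defines "code \<equiv> vandermonde_code R \<alpha> r F sched"
  assumes "field R" and \<alpha>: "\<And>k. \<alpha> k \<in> carrier R" "inj_on \<alpha> {..<F}"
    and slots: "\<And>i J j. is_flow K N i J \<Longrightarrow> j \<in> J \<Longrightarrow>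
      real (card {k. k < F \<and> (i, J, j) \<in> slot_stable (sched k)}) = r i J * real F"
  shows "frame_guarantee R K N r F sched code"
  unfolding frame_guarantee_def
proof (intro allI impI ballI)
  interpret field R by fact
  have valid: "valid_code R sched F code"
    unfolding code_def using \<open>field R\<close> \<alpha>(1) by (rule valid_vandermonde_code)
  fix a :: arrivals and n i :: nat and J m
  assume "is_flow K N i J \<and> 1 \<le> n"
  then have flow: "is_flow K N i J" and n: "1 \<le> n" by auto
  define t0 where "t0 = (n - 1) * F"
  have nF: "n * F = t0 + F" using n by (cases n) (auto simp: t0_def)
  define Q where "Q = queue R sched F code a t0 i J"
  assume mQ: "m \<in> queue R sched F code a ((n - 1) * F) i J"
    and m_rank: "real (card {m' \<in> queue R sched F code a ((n - 1) * F) i J. m' < m}) < r i J * real F"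
  define P where "P = {x \<in> Q. real (queue_rank Q x) < r i J * real F}"
  have mP: "m \<in> P"
    using mQ m_rank by (simp add: P_def Q_def t0_def queue_rank_def)
  have P_arrived: "x < arrived a t0 i J" if "x \<in> P" for x
    using that by (auto simp: P_def Q_def queue_def)
  have finP: "finite P"
    using P_arrived by (intro finite_subset[of P "{..<arrived a t0 i J}"]) auto
  have "in_span R (received sched F code a (n * F) i J j) (unit_vec R m)" if j: "j \<in> J" for j
  proof -
    define X where "X = received sched F code a (n * F) i J j"
    have X_carrier: "v k \<in> carrier R" if "v \<in> X" for v k
      using that valid unfolding X_def received_def valid_code_def by blast
    interpret span_ring R X
      using X_carrier by unfold_locales (auto simp: X_def finite_received)
    define A where "A = {k. k < F \<and> (i, J, j) \<in> slot_stable (sched k)}"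
    have card_A: "real (card A) = r i J * real F"
      unfolding A_def using slots[OF flow j] .
    \<comment> \<open>The ideal row for slot \<open>k\<close>, with no packet omitted for having
      left the queue during the frame.\<close>
    define W where "W k x = (if x \<in> P then \<alpha> k [^] queue_rank Q x else \<zero>)" for k x
    have W_carrier: "W k x \<in> carrier R" for k x
      using \<alpha>(1) by (simp add: W_def)
    have W_span: "in_span R X (W k)" if k: "k \<in> A" for k
    proof -
      define t where "t = t0 + k"
      have "k < F" using k by (simp add: A_def)
      then have t: "t mod F = k" "t div F * F = t0" "t < n * F" "t0 \<le> t"
        by (auto simp: t_def t0_def nF[unfolded t0_def])
      obtain D where D: "sched k i = Some (J, D)" "j \<in> D"
        using k by (auto simp: A_def slot_stable_def)
      have "code a t i \<in> X"
        unfolding X_def received_def using t D by blast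
      \<comment> \<open>The packets omitted from the actual transmission. They arrived before the
        frame and are no longer queued, so they are already decodable at output
        \<open>j\<close>.\<close>
      define P' where "P' = P - queue R sched F code a t i J"
      have code: "code a t i x = (if x \<in> P - P' then \<alpha> k [^] queue_rank Q x else \<zero>)" for x
        using vandermonde_code_eq[where sched = sched and t = t and F = F and i = i and J = J and D = D and Q = Q and R = R and \<alpha> = \<alpha> and r = r and a = a] t(1,2) D(1)
        by (auto simp: code_def[symmetric] Q_def P_def P'_def)
      have W_eq: "W k x = code a t i x \<oplus> (\<Oplus>y\<in>P'. W k y \<otimes> unit_vec R y x)" for x
        using finsum_unit_vec[OF ring_axioms, of P' "W k" x] finP W_carrier[of k x] \<alpha>(1)
        by (auto simp: code W_def P'_def)
      have "in_span R X (\<lambda>x. code a t i x \<oplus> (\<Oplus>y\<in>P'. W k y \<otimes> unit_vec R y x))"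
      proof (intro in_span_add in_span_finsum)
        show "in_span R X (code a t i)"
          using \<open>code a t i \<in> X\<close> by (rule in_span_base)
        fix y assume y: "y \<in> P'"
        then have "y < arrived a t i J"
          using P_arrived[of y] arrived_mono[OF t(4), of a i J] by (simp add: P'_def)
        then have "served R sched F code a t i J y"
          using y by (auto simp: P'_def queue_def)
        then have "in_span R (received sched F code a t i J j) (unit_vec R y)"
          using j by (auto simp: served_def)
        then show "in_span R X (unit_vec R y)"
          unfolding X_def by (rule in_span_mono) (rule received_mono[OF less_imp_le[OF t(3)]])
      qed (use finP W_carrier in \<open>auto simp: P'_def\<close>)
      then show ?thesis
        unfolding W_eq[symmetric] .
    qed
    \<comment> \<open>The right-hand side selects the rank of \<open>m\<close>; as ranks are
      injective on \<open>Q\<close>, the combined rows are nonzero at \<open>m\<close>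
      alone.\<close>
    obtain c where c: "c \<in> A \<rightarrow> carrier R"
      and c_sum: "\<forall>l<card A. (\<Oplus>k\<in>A. c k \<otimes> \<alpha> k [^] l) = (if l = queue_rank Q m then \<one> else \<zero>)"
    proof -
      have "finite A" "inj_on \<alpha> A"
        using \<alpha>(2) by (auto simp: A_def intro: inj_on_subset)
      then have "\<exists>c\<in>A \<rightarrow> carrier R. \<forall>l<card A.
          (\<Oplus>k\<in>A. c k \<otimes> \<alpha> k [^] l) = (if l = queue_rank Q m then \<one> else \<zero>)"
        using \<alpha>(1) by (intro vandermonde_solvable) auto
      then show ?thesis using that by blast
    qed
    have "unit_vec R m x = (\<Oplus>k\<in>A. c k \<otimes> W k x)" for x
    proof (cases "x \<in> P")
      case True
      have "queue_rank Q x < card A"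
        using True card_A by (simp add: P_def)
      then have "(\<Oplus>k\<in>A. c k \<otimes> W k x) = (if queue_rank Q x = queue_rank Q m then \<one> else \<zero>)"
        using c_sum True by (simp add: W_def)
      also have "queue_rank Q x = queue_rank Q m \<longleftrightarrow> x = m"
        using inj_on_rank[of Q] True mP by (auto simp: P_def inj_on_def)
      finally show ?thesis by (simp add: unit_vec_def)
    next
      case False
      have "(\<Oplus>k\<in>A. c k \<otimes> W k x) = \<zero>"
        using c False by (intro add.finprod_one_eqI) (auto simp: W_def Pi_iff)
      then show ?thesis using False mP by (auto simp: unit_vec_def)
    qed
    then have "unit_vec R m = (\<lambda>x. \<Oplus>k\<in>A. c k \<otimes> W k x)" ..
    moreover have "in_span R X (\<lambda>x. \<Oplus>k\<in>A. c k \<otimes> W k x)"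
      using c W_span by (intro in_span_finsum) (auto simp: A_def)
    ultimately show ?thesis
      by (simp only: X_def)
  qed
  moreover have "m < arrived a (n * F) i J"
    using P_arrived[OF mP] arrived_mono[of t0 "n * F" a i J] nF by simp
  ultimately show "served R sched F code a (n * F) i J m"
    unfolding served_def by blast
qed

section \<open>Stable sets as switch configurations\<close>

text \<open>Meant for stable \<open>S\<close>, where each input occurs with at most one fanout set
  and \<open>SOME\<close> has no real choice. An input absent from \<open>S\<close> idles.\<close>

definition stable_config :: "subflow set \<Rightarrow> config" where
  "stable_config S i = (if \<exists>J j. (i, J, j) \<in> S
     then let J = (SOME J. \<exists>j. (i, J, j) \<in> S) in Some (J, {j. (i, J, j) \<in> S}) else None)"

lemma stable_config_eq_Some_iff:
  assumes "stable_set (subflows K N) enh_adj S"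
  shows "stable_config S i = Some (J, D) \<longleftrightarrow> D = {j. (i, J, j) \<in> S} \<and> D \<noteq> {}"
proof -
  have uniq: "J = J'" if "(i, J, j) \<in> S" "(i, J', j') \<in> S" for J J' j j'
    using assms that unfolding stable_set_def enh_adj_def by fastforce
  have "(SOME J. \<exists>j. (i, J, j) \<in> S) = J'" if "(i, J', j') \<in> S" for J' j'
    using that uniq by (intro some_equality) blast+
  then show ?thesis
    by (auto simp: stable_config_def Let_def)
qed

lemma slot_stable_stable_config:
  assumes "stable_set (subflows K N) enh_adj S"
  shows "slot_stable (stable_config S) = S"
  using stable_config_eq_Some_iff[OF assms] by (auto simp: slot_stable_def)

lemma valid_stable_config:
  assumes S: "stable_set (subflows K N) enh_adj S"
  shows "valid_config K N (stable_config S)"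
proof -
  have sub: "is_flow K N i J" "i < K" "j \<in> J" if "(i, J, j) \<in> S" for i J j
    using S that by (auto simp: stable_set_def subflows_def is_flow_def)
  have "i = i'" if "(i, J, j) \<in> S" "(i', J', j) \<in> S" for i i' J J' j
    using S that unfolding stable_set_def enh_adj_def by fastforce
  then have disjoint: "D \<inter> D' = {}"
    if "i \<noteq> i'" "stable_config S i = Some (J, D)" "stable_config S i' = Some (J', D')" for i i' J J' D D'
    using that unfolding stable_config_eq_Some_iff[OF S] by blast
  have flow: "is_flow K N i J \<and> D \<subseteq> J" if "stable_config S i = Some (J, D)" for i J D
    using that sub unfolding stable_config_eq_Some_iff[OF S] by auto
  have "stable_config S i = None" if "K \<le> i" for i
    using sub(2)[of i] that by (auto simp: stable_config_def)
  then show ?thesis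
    unfolding valid_config_def using disjoint flow by (intro conjI allI impI) (simp, blast+)
qed

lemma finite_subflows: "finite (subflows K N)"
  by (rule finite_subset[of _ "{..<K} \<times> Pow {..<N} \<times> {..<N}"]) (auto simp: subflows_def is_flow_def)

theorem theorem6:
  fixes K N :: nat and r :: "nat \<Rightarrow> nat set \<Rightarrow> real"
  assumes rates: "\<forall>i J. is_flow K N i J \<longrightarrow> r i J \<in> \<rat> \<and> 0 \<le> r i J"
  shows "enhanced K N r \<in> STAB (subflows K N) enh_adj \<longleftrightarrow>
    (\<exists>(R :: nat ring) F sched code.
       field R \<and> finite (carrier R) \<and> 0 < F \<and>
       (\<forall>k<F. valid_config K N (sched k)) \<and>
       valid_code R sched F code \<and>
       (\<forall>i J. is_flow K N i J \<longrightarrow> r i J * real F \<in> \<nat>) \<and>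
       frame_guarantee R K N r F sched code)"
proof
  assume stab: "enhanced K N r \<in> STAB (subflows K N) enh_adj"
  have "enhanced K N r v \<in> \<rat>" if "v \<in> subflows K N" for v
    using that rates by (auto simp: enhanced_def subflows_def)
  then obtain F S where "0 < F" and S: "\<And>k. k < F \<Longrightarrow> stable_set (subflows K N) enh_adj (S k)"
    and cnt: "\<And>v. real (card {k. k < F \<and> v \<in> S k}) = enhanced K N r v * real F"
    using STAB_imp_slots[OF stab finite_subflows] by auto
  \<comment> \<open>At least \<open>F\<close> field elements are needed to give the slots of a frame
    distinct evaluation points.\<close>
  obtain R :: "nat ring" where R: "field R" "finite (carrier R)" "F \<le> card (carrier R)"
    by (rule finite_field_nat_exists)
  obtain \<beta> where \<beta>: "\<beta> ` {..<F} \<subseteq> carrier R" "inj_on \<beta> {..<F}"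
    using card_le_inj[of "{..<F}" "carrier R"] R by auto
  \<comment> \<open>The default zero keeps all values in the carrier; injectivity matters only
    within the frame.\<close>
  define \<alpha> where "\<alpha> k = (if k < F then \<beta> k else \<zero>\<^bsub>R\<^esub>)" for k
  interpret field R by (rule R(1))
  have \<alpha>: "\<alpha> k \<in> carrier R" "inj_on \<alpha> {..<F}" for k
    using \<beta> by (auto simp: \<alpha>_def inj_on_def)
  define sched where "sched k = stable_config (S k)" for k
  let ?code = "vandermonde_code R \<alpha> r F sched"
  have slots: "real (card {k. k < F \<and> (i, J, j) \<in> slot_stable (sched k)}) = r i J * real F"
    if "is_flow K N i J" "j \<in> J" for i J j
  proof -
    have "{k. k < F \<and> (i, J, j) \<in> slot_stable (sched k)} = {k. k < F \<and> (i, J, j) \<in> S k}"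
      using slot_stable_stable_config[OF S] by (auto simp: sched_def)
    then show ?thesis
      using cnt[of "(i, J, j)"] that by (simp add: enhanced_def subflows_def)
  qed
  have "\<forall>k<F. valid_config K N (sched k)"
    using valid_stable_config[OF S] by (simp add: sched_def)
  moreover have "valid_code R sched F ?code"
    using R(1) \<alpha>(1) by (rule valid_vandermonde_code)
  \<comment> \<open>A fanout is nonempty, so some output realises \<open>r i J * F\<close> as a
    number of slots.\<close>
  moreover have "r i J * real F \<in> \<nat>" if flow: "is_flow K N i J" for i J
  proof -
    obtain j where "j \<in> J" using flow by (auto simp: is_flow_def)
    then show ?thesis by (simp flip: slots[OF flow])
  qed
  moreover have "frame_guarantee R K N r F sched ?code"
    using R(1) \<alpha> slots by (rule vandermonde_guarantee)
  ultimately show "\<exists>(R :: nat ring) F sched code.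
       field R \<and> finite (carrier R) \<and> 0 < F \<and>
       (\<forall>k<F. valid_config K N (sched k)) \<and>
       valid_code R sched F code \<and>
       (\<forall>i J. is_flow K N i J \<longrightarrow> r i J * real F \<in> \<nat>) \<and>
       frame_guarantee R K N r F sched code"
    using R(1,2) \<open>0 < F\<close> by blast
next
  assume "\<exists>(R :: nat ring) F sched code.
       field R \<and> finite (carrier R) \<and> 0 < F \<and>
       (\<forall>k<F. valid_config K N (sched k)) \<and>
       valid_code R sched F code \<and>
       (\<forall>i J. is_flow K N i J \<longrightarrow> r i J * real F \<in> \<nat>) \<and>
       frame_guarantee R K N r F sched code"
  then show "enhanced K N r \<in> STAB (subflows K N) enh_adj"
    using STAB_if_guarantee by blast
qed

end
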